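(* Let $m$ be an upper bound on the number of packing constraints and $d$ an upper bound on the number of variables in any constraint. Every deterministic online algorithm for online mixed packing and covering has competitive ratio $\Omega(\log(d/\log m)\log m)$; that is, there are instances respecting these bounds on which the algorithm's value $\max_k(\mathbf{P}\mathbf{x})_k$ is at least $\Omega(\log(d/\log m)\log m)$ times $OPT$.
   Context: Online mixed packing and covering: there are nonnegative variables $\mathbf{x}$; a nonnegative matrix $\mathbf{P}$ of packing constraints is known in advance, and covering constraints $(\mathbf{C}\mathbf{x})_i\ge 1$ with nonnegative coefficients arrive one at a time. After each arrival the algorithm may only increase variables and must satisfy the new covering constraint. The objective is $\max_k(\mathbf{P}\mathbf{x})_k$, to be minimized; $OPT$ is the optimal offline value $\min\{\lambda:\mathbf{C}\mathbf{x}\ge\mathbf{1},\mathbf{P}\mathbf{x}\le\lambda\mathbf{1},\mathbf{x}\ge 0\}$. The competitive ratio of an online algorithm is the worst case, over inputs, of the ratio of its objective value to $OPT$. *)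

theory Defs
  imports
    "HOL-Library.Extended_Real"
    "Jordan_Normal_Form.Matrix"
begin

definition num_vars :: "real vec \<Rightarrow> nat" where
  "num_vars r = card {j. j < dim_vec r \<and> r $ j \<noteq> 0}"

definition covers :: "real vec list \<Rightarrow> real vec \<Rightarrow> bool" where
  "covers cs x \<longleftrightarrow> (\<forall>c\<in>set cs. 1 \<le> c \<bullet> x)"

text \<open>Feasible points need not respect any packing bound: the packing constraints only enter
  through the objective.\<close>

definition feasible :: "real mat \<Rightarrow> real vec list \<Rightarrow> real vec \<Rightarrow> bool" where
  "feasible P cs x \<longleftrightarrow> x \<in> carrier_vec (dim_col P) \<and> 0\<^sub>v (dim_col P) \<le> x \<and> covers cs x"

text \<open>An input consists of a packing matrix \<open>P\<close>, whose columns are the variables, and the covering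
  rows \<open>cs\<close> in their order of arrival. There is at least one packing row, so that the
  objective is a maximum over a nonempty set, and the offline problem has a solution. The number
  of columns is not bounded: \<open>d\<close> only limits how many variables occur in a single row,
  packing or covering. Every prefix of an input is again an input.\<close>

definition ompc_input :: "nat \<Rightarrow> nat \<Rightarrow> real mat \<Rightarrow> real vec list \<Rightarrow> bool" where
  "ompc_input m d P cs \<longleftrightarrow>
     1 \<le> dim_row P \<and> dim_row P \<le> m \<and>
     (\<forall>k < dim_row P. 0\<^sub>v (dim_col P) \<le> row P k \<and> num_vars (row P k) \<le> d) \<and>
     (\<forall>c\<in>set cs. c \<in> carrier_vec (dim_col P) \<and> 0\<^sub>v (dim_col P) \<le> c \<and> num_vars c \<le> d) \<and>
     (\<exists>x. feasible P cs x)"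

definition objective :: "real mat \<Rightarrow> real vec \<Rightarrow> real" where
  "objective P x = Max {(P *\<^sub>v x) $ k | k. k < dim_row P}"

definition OPT :: "real mat \<Rightarrow> real vec list \<Rightarrow> real" where
  "OPT P cs = Inf {l. \<exists>x. feasible P cs x \<and> P *\<^sub>v x \<le> vec (dim_row P) (\<lambda>_. l)}"

text \<open>A deterministic online algorithm maps \<open>P\<close> and the covering rows received so far to its
  current solution. It only has to work on inputs respecting the bounds \<open>m\<close> and \<open>d\<close> (hence it
  may know them), and its solution before the first arrival may be any nonnegative vector; both
  choices admit more algorithms than insisting on all inputs or on starting at zero.\<close>

type_synonym online_alg = "real mat \<Rightarrow> real vec list \<Rightarrow> real vec"

definition online_algorithm :: "nat \<Rightarrow> nat \<Rightarrow> online_alg \<Rightarrow> bool" where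
  "online_algorithm m d A \<longleftrightarrow>
     (\<forall>P cs. ompc_input m d P cs \<longrightarrow> feasible P cs (A P cs)) \<and>
     (\<forall>P cs c. ompc_input m d P (cs @ [c]) \<longrightarrow> A P cs \<le> A P (cs @ [c]))"

text \<open>Inputs with optimal value 0, on which the ratio is undefined, are left out of the supremum.
  This can only decrease the competitive ratio.\<close>

definition competitive_ratio :: "nat \<Rightarrow> nat \<Rightarrow> online_alg \<Rightarrow> ereal" where
  "competitive_ratio m d A =
     (SUP (P, cs) \<in> {(P, cs). ompc_input m d P cs \<and> OPT P cs > 0}.
        ereal (objective P (A P cs) / OPT P cs))"

end

theory Submission
  imports "HOL-Analysis.Harmonic_Numbers" Defs
begin

unbundle no vec_syntax

text \<open>The adversary plays a knockout tournament. There are \<open>2 ^ L\<close> packing rows, and for every row \<open>k\<close>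
  and round \<open>l < L\<close> there are \<open>D\<close> variables \<open>(k, l, j)\<close>, with coefficient 1 in row \<open>k\<close> and 0 in the
  others. When \<open>k1\<close> and \<open>k2\<close> meet in round \<open>l\<close>, the adversary first requests that the \<open>2 D\<close> variables
  \<open>(k1, l, _)\<close>, \<open>(k2, l, _)\<close> sum to at least 1, then drops the index \<open>j\<close> whose pair
  \<open>(k1, l, j)\<close>, \<open>(k2, l, j)\<close> is heaviest, requests the same for the remaining indices, and so on. The
  dropped pairs weigh at least \<open>1 / D\<close>, \<open>1 / (D - 1)\<close>, and so on up to \<open>1\<close>, so one of the two rows
  gains at least half the harmonic number of \<open>D\<close>; that row advances. The final
  winner thus carries load \<open>L * harm D / 2\<close>. Offline, the last surviving pair of a match lies in all
  requests of that match, so setting to 1 the loser's variable in that pair serves the match. As every row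
  loses at most once, this has value at most 1. Taking \<open>L\<close> about \<open>log 2 m\<close> and \<open>D\<close> about \<open>d / (2 * L)\<close>
  gives the bound.\<close>

section \<open>Requests and the game of a single match\<close>

definition requests :: "'a set \<Rightarrow> nat \<Rightarrow> 'a set list \<Rightarrow> bool" where
  "requests U d Cs \<longleftrightarrow> (\<forall>C\<in>set Cs. C \<subseteq> U \<and> C \<noteq> {} \<and> card C \<le> d)"

lemma requests_append [simp]:
  "requests U d (Cs @ Cs') \<longleftrightarrow> requests U d Cs \<and> requests U d Cs'"
  by (auto simp: requests_def)

lemma requests_Nil [simp]: "requests U d []"
  by (simp add: requests_def)

lemma requests_Cons [simp]:
  "requests U d (C # Cs) \<longleftrightarrow> C \<subseteq> U \<and> C \<noteq> {} \<and> card C \<le> d \<and> requests U d Cs"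
  by (auto simp: requests_def)

text \<open>The requests \<open>Cs\<close> stand for covering rows with 0/1 coefficients, \<open>X Cs\<close> for the online
  solution after they have arrived.\<close>

locale covering_game =
  fixes U :: "'a set" and d :: nat and X :: "'a set list \<Rightarrow> 'a \<Rightarrow> real"
  assumes nonneg: "requests U d Cs \<Longrightarrow> q \<in> U \<Longrightarrow> 0 \<le> X Cs q"
    and covered: "requests U d Cs \<Longrightarrow> C \<in> set Cs \<Longrightarrow> 1 \<le> sum (X Cs) C"
    and step: "requests U d (Cs @ [C]) \<Longrightarrow> q \<in> U \<Longrightarrow> X Cs q \<le> X (Cs @ [C]) q"
begin

lemma increasing: "requests U d (Cs @ Cs') \<Longrightarrow> q \<in> U \<Longrightarrow> X Cs q \<le> X (Cs @ Cs') q"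
proof (induction Cs' rule: rev_induct)
  case (snoc C Cs')
  then show ?case using step[of "Cs @ Cs'" C q] by force
qed simp

text \<open>Induction on \<open>card J\<close>: request all remaining pairs, drop one of at least
  average weight, recurse. \<open>f j\<close> and \<open>g j\<close> are the two rows' variables for
  index \<open>j\<close>; the returned \<open>j\<close> is the last survivor, hence present in every
  request. The history \<open>Cs\<close> stays arbitrary because it lengthens with each
  request.\<close>

lemma pair_game:
  assumes "finite J" "J \<noteq> {}" "f ` J \<subseteq> U" "g ` J \<subseteq> U" "inj_on f J" "inj_on g J"
    and "f ` J \<inter> g ` J = {}" "2 * card J \<le> d" "requests U d Cs"
  shows "\<exists>Cs' j. requests U d Cs' \<and> Cs' \<noteq> [] \<and> j \<in> J \<and> (\<forall>C\<in>set Cs'. f j \<in> C \<and> g j \<in> C) \<and>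
    harm (card J) \<le> (\<Sum>j\<in>J. X (Cs @ Cs') (f j) + X (Cs @ Cs') (g j))"
  using assms
proof (induction "card J" arbitrary: J Cs)
  case 0
  then show ?case by simp
next
  case (Suc n)
  define C where "C = f ` J \<union> g ` J"
  define w where "w Cs j = X Cs (f j) + X Cs (g j)" for Cs j
  have "card C \<le> card J + card J"
    unfolding C_def by (rule order.trans[OF card_Un_le add_mono]) (auto simp: Suc.prems card_image_le)
  then have C: "requests U d [C]" using Suc.prems by (auto simp: C_def)
  then have CsC: "requests U d (Cs @ [C])" using Suc.prems by simp
  have "sum (X (Cs @ [C])) C = sum (w (Cs @ [C])) J"
    unfolding C_def w_def using Suc.prems by (simp add: sum.union_disjoint sum.reindex sum.distrib)
  then have total: "1 \<le> sum (w (Cs @ [C])) J" using covered[OF CsC, of C] by simp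
  obtain j where j: "j \<in> J" "1 / real (card J) \<le> w (Cs @ [C]) j"
  proof (rule ccontr)
    assume "\<not> thesis"
    with that have "\<And>j. j \<in> J \<Longrightarrow> w (Cs @ [C]) j < 1 / real (card J)" by force
    then have "sum (w (Cs @ [C])) J < (\<Sum>j\<in>J. 1 / real (card J))"
      by (intro sum_strict_mono) (use Suc.prems in auto)
    with total show False using Suc.hyps by (auto split: if_splits)
  qed
  \<comment> \<open>Variables never decrease, so the weight of the dropped pair at the time of its
    removal still counts in the final sum.\<close>
  have grow: "1 / real (card J) \<le> w ((Cs @ [C]) @ Cs') j" if "requests U d Cs'" for Cs'
  proof -
    have "w (Cs @ [C]) j \<le> w ((Cs @ [C]) @ Cs') j"
      unfolding w_def by (intro add_mono increasing) (use CsC that j Suc.prems in auto)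
    with j show ?thesis by linarith
  qed
  have card: "card (J - {j}) = n" using j Suc.hyps by simp
  have split: "sum (w Cs') J = w Cs' j + sum (w Cs') (J - {j})" for Cs'
    using j Suc.prems by (simp add: sum.remove)
  show ?case
  \<comment> \<open>The last pair is kept: it is the survivor to be returned, and the induction
    hypothesis needs a nonempty set.\<close>
  proof (cases "n = 0")
    case True
    then have "J = {j}" using j Suc.hyps by (metis One_nat_def card_1_singletonE singletonD)
    then show ?thesis
      using C j grow[of "[]"] split[of "Cs @ [C]"] True Suc.hyps
      by (intro exI[of _ "[C]"] exI[of _ j]) (auto simp: harm_def w_def C_def)
  next
    case False
    have "\<exists>Cs' i. requests U d Cs' \<and> Cs' \<noteq> [] \<and> i \<in> J - {j} \<and>
        (\<forall>C\<in>set Cs'. f i \<in> C \<and> g i \<in> C) \<and>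
        harm (card (J - {j})) \<le> sum (w ((Cs @ [C]) @ Cs')) (J - {j})"
      unfolding w_def
    proof (rule Suc.hyps(1))
      show "J - {j} \<noteq> {}" using False card by force
      show "f ` (J - {j}) \<inter> g ` (J - {j}) = {}" using Suc.prems by blast
      show "2 * card (J - {j}) \<le> d" using Suc.prems card Suc.hyps by linarith
    qed (use Suc.prems card CsC in \<open>auto intro: inj_on_diff\<close>)
    then obtain Cs' i where i: "requests U d Cs'" "i \<in> J - {j}" "\<forall>C\<in>set Cs'. f i \<in> C \<and> g i \<in> C"
        "harm n \<le> sum (w ((Cs @ [C]) @ Cs')) (J - {j})"
      unfolding card by blast
    moreover have "harm (card J) = harm n + 1 / real (card J)"
      by (metis harm_Suc inverse_eq_divide Suc.hyps(2))
    ultimately have "harm (card J) \<le> sum (w (Cs @ C # Cs')) J"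
      using grow[OF i(1)] split[of "Cs @ C # Cs'"] by simp
    with i C show ?thesis
      by (intro exI[of _ "C # Cs'"] exI[of _ i]) (auto simp: w_def C_def)
  qed
qed

end

section \<open>The knockout tournament\<close>

text \<open>\<open>Y\<close> is the support of the offline solution and \<open>k\<close> the row that wins the subtournament of the
  rows \<open>a, \<dots>, a + 2 ^ l - 1\<close>. That \<open>k\<close> is not used by \<open>Y\<close> lets it still lose a later
  match.\<close>

lemma tournament:
  fixes N L D :: nat
  assumes "covering_game ({..<N} \<times> {..<L} \<times> {..<D}) d X"
    and D: "0 < D" "2 * D \<le> d" and "l \<le> L" "a + 2 ^ l \<le> N" "requests ({..<N} \<times> {..<L} \<times> {..<D}) d Cs"
  shows "\<exists>Cs' Y k. requests ({..<N} \<times> {..<L} \<times> {..<D}) d Cs' \<and> (0 < l \<longrightarrow> Cs' \<noteq> []) \<and>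
    Y \<subseteq> {a..<a + 2 ^ l} \<times> {..<l} \<times> {..<D} \<and> inj_on fst Y \<and> (\<forall>C\<in>set Cs'. C \<inter> Y \<noteq> {}) \<and>
    k \<in> {a..<a + 2 ^ l} \<and> k \<notin> fst ` Y \<and>
    real l * harm D / 2 \<le> (\<Sum>i<l. \<Sum>j<D. X (Cs @ Cs') (k, i, j))"
  using assms(4-)
proof (induction l arbitrary: a Cs)
  case 0
  show ?case
    by (intro exI[of _ "[]"] exI[of _ "{}"] exI[of _ a]) auto
next
  case (Suc l)
  let ?U = "{..<N} \<times> {..<L} \<times> {..<D}"
  interpret covering_game ?U d X by fact
  define load where "load Cs k = (\<Sum>i<l. \<Sum>j<D. X Cs (k, i, j))" for Cs k
  have load_mono: "load Cs k \<le> load (Cs @ Cs') k"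
    if "requests ?U d (Cs @ Cs')" "k < N" for Cs Cs' k
    unfolding load_def by (intro sum_mono increasing that) (use Suc.prems that in auto)
  define b where "b = a + 2 ^ l"
  have ab: "a + 2 ^ Suc l = b + 2 ^ l" by (simp add: b_def)
  obtain Cs1 Y1 k1 where 1: "requests ?U d Cs1" "Y1 \<subseteq> {a..<b} \<times> {..<l} \<times> {..<D}"
      "inj_on fst Y1" "\<forall>C\<in>set Cs1. C \<inter> Y1 \<noteq> {}" "k1 \<in> {a..<b}" "k1 \<notin> fst ` Y1"
      "real l * harm D / 2 \<le> load (Cs @ Cs1) k1"
    using Suc.IH[of a Cs] Suc.prems ab unfolding load_def b_def by fastforce
  \<comment> \<open>The second half plays after the first, with \<open>Cs @ Cs1\<close> as its
    history; \<open>load_mono\<close> later carries the load of \<open>k1\<close> forward.\<close>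
  obtain Cs2 Y2 k2 where 2: "requests ?U d Cs2" "Y2 \<subseteq> {b..<b + 2 ^ l} \<times> {..<l} \<times> {..<D}"
      "inj_on fst Y2" "\<forall>C\<in>set Cs2. C \<inter> Y2 \<noteq> {}" "k2 \<in> {b..<b + 2 ^ l}" "k2 \<notin> fst ` Y2"
      "real l * harm D / 2 \<le> load ((Cs @ Cs1) @ Cs2) k2"
    using Suc.IH[of b "Cs @ Cs1"] Suc.prems ab 1(1) unfolding load_def by fastforce
  have k: "k1 \<noteq> k2" "k1 < N" "k2 < N" using 1 2 Suc.prems ab by auto
  let ?f = "\<lambda>j. (k1, l, j)" and ?g = "\<lambda>j. (k2, l, j)"
  let ?Ds = "(Cs @ Cs1) @ Cs2"
  \<comment> \<open>\<open>load\<close> counts only rounds below \<open>l\<close>, so whatever the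
    match adds to the round \<open>l\<close> variables comes on top of it.\<close>
  have "\<exists>Cs' j. requests ?U d Cs' \<and> Cs' \<noteq> [] \<and> j \<in> {..<D} \<and> (\<forall>C\<in>set Cs'. ?f j \<in> C \<and> ?g j \<in> C) \<and>
    harm (card {..<D}) \<le> (\<Sum>j\<in>{..<D}. X (?Ds @ Cs') (?f j) + X (?Ds @ Cs') (?g j))"
    by (rule pair_game) (use D k Suc.prems 1 2 in \<open>auto simp: inj_on_def\<close>)
  then obtain Cs3 j where 3: "requests ?U d Cs3" "Cs3 \<noteq> []" "j < D"
      "\<forall>C\<in>set Cs3. (k1, l, j) \<in> C \<and> (k2, l, j) \<in> C"
      "harm D \<le> (\<Sum>j<D. X (?Ds @ Cs3) (k1, l, j)) + (\<Sum>j<D. X (?Ds @ Cs3) (k2, l, j))"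
    by (auto simp: sum.distrib)
  define F where "F = ?Ds @ Cs3"
  have reqs: "requests ?U d (?Ds @ Cs3)" using 1 2 3 Suc.prems by simp
  have F: "real l * harm D / 2 \<le> load F k1" "real l * harm D / 2 \<le> load F k2"
    using load_mono[of "Cs @ Cs1" "Cs2 @ Cs3" k1] load_mono[of ?Ds Cs3 k2] reqs k 1(7) 2(7)
    by (auto simp: F_def)
  obtain winner loser where wl: "(winner, loser) \<in> {(k1, k2), (k2, k1)}"
      "harm D / 2 \<le> (\<Sum>j<D. X F (winner, l, j))"
    using 3(5) by (fold F_def) (cases "harm D / 2 \<le> (\<Sum>j<D. X F (k1, l, j))"; force)
  \<comment> \<open>The variable \<open>(loser, l, j)\<close> lies in every request of
    \<open>Cs3\<close>. Neither finalist's row occurs in \<open>Y1\<close> or \<open>Y2\<close>, so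
    there is still at most one variable per row.\<close>
  let ?Y = "insert (loser, l, j) (Y1 \<union> Y2)"
  show ?case
  proof (intro exI[of _ "Cs1 @ Cs2 @ Cs3"] exI[of _ ?Y] exI[of _ winner] conjI)
    have disj: "fst ` Y1 \<inter> fst ` Y2 = {}" using 1(2) 2(2) by fastforce
    have sep: "fst ` Y1 \<subseteq> {a..<b}" "fst ` Y2 \<subseteq> {b..<b + 2 ^ l}" using 1(2) 2(2) by auto
    have out: "k1 \<notin> fst ` (Y1 \<union> Y2)" "k2 \<notin> fst ` (Y1 \<union> Y2)"
      using sep 1 2 unfolding image_Un by fastforce+
    show "inj_on fst ?Y"
    proof -
      have "inj_on fst (Y1 \<union> Y2)" using 1(3) 2(3) disj by (auto simp: inj_on_Un)
      moreover have "loser \<notin> fst ` (Y1 \<union> Y2)" using out wl by auto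
      ultimately show ?thesis by auto
    qed
    show "winner \<notin> fst ` ?Y" using out wl k by auto
    show "?Y \<subseteq> {a..<a + 2 ^ Suc l} \<times> {..<Suc l} \<times> {..<D}"
      unfolding ab using 1(2,5) 2(2,5) 3(3) wl(1) by (auto simp: b_def)
    show "winner \<in> {a..<a + 2 ^ Suc l}" using 1(5) 2(5) wl(1) unfolding ab by (auto simp: b_def)
    show "\<forall>C\<in>set (Cs1 @ Cs2 @ Cs3). C \<inter> ?Y \<noteq> {}" using 1(4) 2(4) 3(4) wl(1) by auto
    have "real l * harm D / 2 \<le> load F winner" using F wl(1) by auto
    with wl(2) have "real l * harm D / 2 + harm D / 2 \<le> (\<Sum>i<Suc l. \<Sum>j<D. X F (winner, i, j))"
      by (simp add: load_def)
    then show "real (Suc l) * harm D / 2 \<le>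
        (\<Sum>i<Suc l. \<Sum>j<D. X (Cs @ Cs1 @ Cs2 @ Cs3) (winner, i, j))"
      by (simp add: F_def distrib_right add_divide_distrib add.commute)
    show "requests ?U d (Cs1 @ Cs2 @ Cs3)" using 1(1) 2(1) 3(1) by simp
    show "0 < Suc l \<longrightarrow> Cs1 @ Cs2 @ Cs3 \<noteq> []" using 3(2) by simp
  qed
qed

section \<open>From the game to packing and covering instances\<close>

text \<open>Transfers an adversary that beats every \<open>X\<close> to the online algorithm.
  Elements of \<open>U\<close> become variables, \<open>machine\<close> gives the packing row of
  each, and \<open>R\<close> is the load forced on some row. As \<open>Y\<close> meets every request
  and has at most one element per row, its indicator vector shows that the offline value is at most
  1.\<close>

lemma instance_of_game:
  fixes machine :: "'a \<Rightarrow> nat"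
  assumes U: "finite U" "machine ` U \<subseteq> {..<M}" and M: "1 \<le> M" "M \<le> m"
    and load: "\<And>k. card {q \<in> U. machine q = k} \<le> d"
    and A: "online_algorithm m d A"
    and game: "\<And>X. covering_game U d X \<Longrightarrow> \<exists>Cs Y k. requests U d Cs \<and> Cs \<noteq> [] \<and>
      Y \<subseteq> U \<and> inj_on machine Y \<and> (\<forall>C\<in>set Cs. C \<inter> Y \<noteq> {}) \<and> k < M \<and>
      R \<le> (\<Sum>q\<in>{q \<in> U. machine q = k}. X Cs q)"
  shows "\<exists>P cs. ompc_input m d P cs \<and> 0 < OPT P cs \<and> OPT P cs \<le> 1 \<and> R \<le> objective P (A P cs)"
proof -
  define n where "n = card U"
  obtain dec where dec: "bij_betw dec {..<n} U"
    using ex_bij_betw_nat_finite[OF U(1)] unfolding n_def atLeast0LessThan by blast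
  define enc where "enc = inv_into {..<n} dec"
  have enc: "enc q < n" "dec (enc q) = q" if "q \<in> U" for q
    using that dec unfolding enc_def
    by (metis bij_betw_def inv_into_into lessThan_iff, metis bij_betw_inv_into_right)
  have dec_U: "dec i \<in> U" if "i < n" for i using dec that by (auto simp: bij_betw_def)
  have dec_preimage: "bij_betw dec {i. i < n \<and> dec i \<in> C} C" if "C \<subseteq> U" for C
    using dec that by (auto simp: bij_betw_def inj_on_def image_iff subset_iff)
  define ind :: "'a set \<Rightarrow> real vec" where "ind C = vec n (\<lambda>i. if dec i \<in> C then 1 else 0)" for C
  have ind_carrier [simp]: "ind C \<in> carrier_vec n" "dim_vec (ind C) = n" for C
    by (auto simp: ind_def)
  have ind_nonneg: "0\<^sub>v n \<le> ind C" for C by (auto simp: ind_def less_eq_vec_def)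
  have ind_prod: "ind C \<bullet> x = (\<Sum>q\<in>C. x $ enc q)" if "C \<subseteq> U" "x \<in> carrier_vec n" for C x
  proof -
    have "ind C \<bullet> x = (\<Sum>i\<in>{i. i < n \<and> dec i \<in> C}. x $ i)"
      using that by (auto simp: scalar_prod_def ind_def split: if_splits intro!: sum.mono_neutral_cong_right)
    also have "\<dots> = (\<Sum>i\<in>{i. i < n \<and> dec i \<in> C}. x $ enc (dec i))"
      using dec by (intro sum.cong) (auto simp: enc_def bij_betw_def inv_into_f_f)
    also have "\<dots> = (\<Sum>q\<in>C. x $ enc q)"
      by (rule sum.reindex_bij_betw[OF dec_preimage[OF that(1)]])
    finally show ?thesis .
  qed
  have ind_vars: "num_vars (ind C) = card C" if "C \<subseteq> U" for C
  proof -
    have "{j. j < dim_vec (ind C) \<and> ind C $ j \<noteq> 0} = {i. i < n \<and> dec i \<in> C}"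
      by (auto simp: ind_def split: if_splits)
    then show ?thesis unfolding num_vars_def using bij_betw_same_card[OF dec_preimage[OF that]] by simp
  qed
  define cell where "cell k = {q \<in> U. machine q = k}" for k
  have cell_U: "cell k \<subseteq> U" for k by (auto simp: cell_def)
  define P where "P = mat_of_rows n (map (\<lambda>k. ind (cell k)) [0..<M])"
  have P: "dim_row P = M" "dim_col P = n" by (auto simp: P_def)
  have row: "row P k = ind (cell k)" if "k < M" for k
    using that by (simp add: P_def mat_of_rows_row)
  have load_eq: "(P *\<^sub>v x) $ k = (\<Sum>q\<in>cell k. x $ enc q)" if "k < M" "x \<in> carrier_vec n" for k x
    using that by (simp add: P row ind_prod[OF cell_U])
  have feasible_iff: "feasible P (map ind Cs) x \<longleftrightarrow>
      x \<in> carrier_vec n \<and> 0\<^sub>v n \<le> x \<and> (\<forall>C\<in>set Cs. 1 \<le> (\<Sum>q\<in>C. x $ enc q))"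
    if "requests U d Cs" for Cs x
    using that ind_prod by (auto simp: feasible_def covers_def P requests_def)
  have input: "ompc_input m d P (map ind Cs)" if "requests U d Cs" for Cs
    unfolding ompc_input_def
  proof (intro conjI)
    \<comment> \<open>The all-ones vector is feasible because requests are nonempty.\<close>
    have "1 \<le> (\<Sum>q\<in>C. vec n (\<lambda>_. 1 :: real) $ enc q)" if "C \<in> set Cs" for C
    proof -
      have "C \<subseteq> U" "C \<noteq> {}" using that \<open>requests U d Cs\<close> by (auto simp: requests_def)
      moreover from this have "0 < card C" using U by (simp add: card_gt_0_iff finite_subset)
      ultimately show ?thesis using enc by (subst sum.cong[OF refl, of _ _ "\<lambda>_. 1"]) auto
    qed
    then show "\<exists>x. feasible P (map ind Cs) x"
      by (intro exI[of _ "vec n (\<lambda>_. 1)"]) (auto simp: feasible_iff[OF that] less_eq_vec_def)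
    show "\<forall>k<dim_row P. 0\<^sub>v (dim_col P) \<le> row P k \<and> num_vars (row P k) \<le> d"
      using load by (simp add: P row ind_nonneg ind_vars[OF cell_U]) (simp add: cell_def)
    show "\<forall>c\<in>set (map ind Cs). c \<in> carrier_vec (dim_col P) \<and> 0\<^sub>v (dim_col P) \<le> c \<and> num_vars c \<le> d"
      using that by (auto simp: P ind_nonneg ind_vars requests_def)
  qed (use M in \<open>auto simp: P\<close>)
  \<comment> \<open>The algorithm plays the game: \<open>P\<close> is fixed beforehand, so its
    answers depend on the requests alone.\<close>
  define X where "X Cs q = A P (map ind Cs) $ enc q" for Cs q
  have feas: "feasible P (map ind Cs) (A P (map ind Cs))" if "requests U d Cs" for Cs
    using A input[OF that] by (auto simp: online_algorithm_def)
  have "covering_game U d X"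
  proof
    fix Cs q
    assume *: "requests U d Cs" "q \<in> U"
    then have "0\<^sub>v n \<le> A P (map ind Cs)" "A P (map ind Cs) \<in> carrier_vec n"
      using feas feasible_iff by blast+
    then show "0 \<le> X Cs q" using enc(1)[OF *(2)] by (auto simp: X_def less_eq_vec_def)
  next
    fix Cs C
    assume "requests U d Cs" "C \<in> set Cs"
    then show "1 \<le> sum (X Cs) C" using feas by (auto simp: feasible_iff X_def)
  next
    fix Cs C q
    assume *: "requests U d (Cs @ [C])" "q \<in> U"
    then have "A P (map ind Cs) \<le> A P (map ind (Cs @ [C]))"
      using A input[OF *(1)] by (auto simp: online_algorithm_def)
    moreover have "A P (map ind (Cs @ [C])) \<in> carrier_vec n"
      using feas[OF *(1)] feasible_iff[OF *(1)] by blast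
    ultimately show "X Cs q \<le> X (Cs @ [C]) q"
      using enc * by (auto simp: X_def less_eq_vec_def)
  qed
  from game[OF this] obtain Cs Y k where Cs: "requests U d Cs" "Cs \<noteq> []"
      and Y: "Y \<subseteq> U" "inj_on machine Y" "\<forall>C\<in>set Cs. C \<inter> Y \<noteq> {}"
      and k: "k < M" "R \<le> (\<Sum>q\<in>cell k. X Cs q)"
    unfolding cell_def by blast
  let ?cs = "map ind Cs"
  let ?V = "{l. \<exists>x. feasible P ?cs x \<and> P *\<^sub>v x \<le> vec (dim_row P) (\<lambda>_. l)}"
  obtain C where C: "C \<in> set Cs" using Cs(2) by (cases Cs) auto
  then have CU: "C \<subseteq> U" "C \<noteq> {}" using Cs by (auto simp: requests_def)
  then have cardC: "0 < card C" using U by (simp add: card_gt_0_iff finite_subset)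
  \<comment> \<open>Each variable of \<open>C\<close> is at most the load of its row, hence at most
    \<open>l\<close>, while together they reach 1. This makes \<open>OPT\<close> positive and bounds
    \<open>?V\<close> below, as \<open>Inf\<close> requires.\<close>
  have lower: "1 / real (card C) \<le> l" if "l \<in> ?V" for l
  proof -
    from that obtain x where x: "feasible P ?cs x" and Px: "P *\<^sub>v x \<le> vec M (\<lambda>_. l)"
      by (auto simp: P)
    have xn: "x \<in> carrier_vec n" "0\<^sub>v n \<le> x" and x1: "1 \<le> (\<Sum>q\<in>C. x $ enc q)"
      using x C unfolding feasible_iff[OF Cs(1)] by blast+
    have x_nonneg: "0 \<le> x $ enc q" if "q \<in> U" for q
      using xn enc(1)[OF that] by (simp add: less_eq_vec_def)
    have "x $ enc q \<le> l" if "q \<in> C" for q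
    proof -
      have q: "q \<in> U" "machine q < M" using that CU U by auto
      have "x $ enc q \<le> (\<Sum>q\<in>cell (machine q). x $ enc q)"
        by (rule member_le_sum) (use q x_nonneg U in \<open>auto simp: cell_def\<close>)
      also have "\<dots> \<le> l" using Px q load_eq[OF q(2) xn(1)] by (auto simp: less_eq_vec_def P simp del: index_mult_mat_vec)
      finally show ?thesis .
    qed
    then have "(\<Sum>q\<in>C. x $ enc q) \<le> real (card C) * l" by (intro sum_bounded_above) auto
    with x1 show ?thesis using cardC by (simp add: field_simps)
  qed
  have ind_Y: "ind Y $ enc q = (if q \<in> Y then 1 else 0)" if "q \<in> U" for q
    using that enc by (simp add: ind_def)
  have sum_Y: "(\<Sum>q\<in>S. ind Y $ enc q) = real (card (S \<inter> Y))" if "S \<subseteq> U" for S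
  proof -
    have "(\<Sum>q\<in>S. ind Y $ enc q) = (\<Sum>q\<in>S. if q \<in> Y then 1 else 0)"
      using that by (intro sum.cong) (auto simp: ind_Y)
    then show ?thesis using that U by (simp add: sum.If_cases finite_subset)
  qed
  have "1 \<in> ?V"
  proof (intro CollectI exI conjI)
    have "1 \<le> (\<Sum>q\<in>C'. ind Y $ enc q)" if "C' \<in> set Cs" for C'
    proof -
      have "C' \<subseteq> U" "C' \<inter> Y \<noteq> {}" using that Cs Y by (auto simp: requests_def)
      moreover from this have "0 < card (C' \<inter> Y)" using U by (auto simp: card_gt_0_iff finite_subset)
      ultimately show ?thesis by (simp add: sum_Y)
    qed
    then show "feasible P ?cs (ind Y)" by (auto simp: feasible_iff[OF Cs(1)] ind_nonneg)
    have "card (cell i \<inter> Y) \<le> 1" for i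
    proof -
      have "inj_on machine (cell i \<inter> Y)" using Y by (auto intro: inj_on_subset)
      then have "card (cell i \<inter> Y) = card (machine ` (cell i \<inter> Y))" by (simp add: card_image)
      also have "\<dots> \<le> card {i}" by (intro card_mono) (auto simp: cell_def)
      finally show ?thesis by simp
    qed
    then show "P *\<^sub>v ind Y \<le> vec (dim_row P) (\<lambda>_. 1)"
      using load_eq[OF _ ind_carrier(1)]
      by (auto simp: less_eq_vec_def P sum_Y[OF cell_U] simp del: index_mult_mat_vec)
  qed
  then have "OPT P ?cs \<le> 1"
    unfolding OPT_def by (rule cInf_lower) (rule bdd_belowI[OF lower])
  moreover have "1 / real (card C) \<le> OPT P ?cs"
    unfolding OPT_def using \<open>1 \<in> ?V\<close> by (intro cInf_greatest lower) blast
  moreover have "R \<le> objective P (A P ?cs)"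
  proof -
    have "A P ?cs \<in> carrier_vec n" using feas[OF Cs(1)] feasible_iff[OF Cs(1)] by blast
    from load_eq[OF k(1) this] have "(P *\<^sub>v A P ?cs) $ k = (\<Sum>q\<in>cell k. X Cs q)" unfolding X_def .
    moreover have "(P *\<^sub>v A P ?cs) $ k \<le> objective P (A P ?cs)"
      unfolding objective_def using k by (intro Max_ge) (auto simp: P simp del: index_mult_mat_vec)
    ultimately show ?thesis using k by linarith
  qed
  moreover have "0 < 1 / real (card C)" using cardC by simp
  ultimately show ?thesis
    using input[OF Cs(1)] by (intro exI[of _ P] exI[of _ ?cs] conjI) (assumption | linarith)+
qed

section \<open>Concrete instances and the choice of parameters\<close>

text \<open>Serves \<open>d = 1\<close>, where no request can involve two rows: a single variable in
  a single row is forced up to 1.\<close>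

lemma trivial_instance:
  assumes "1 \<le> m" "1 \<le> d" "online_algorithm m d A"
  shows "\<exists>P cs. ompc_input m d P cs \<and> 0 < OPT P cs \<and> OPT P cs \<le> 1 \<and> 1 \<le> objective P (A P cs)"
proof (rule instance_of_game[where U = "{0 :: nat}" and machine = "\<lambda>q. q" and M = 1])
  have cell: "{q \<in> {0 :: nat}. q = k} \<subseteq> {0}" for k by auto
  show "card {q \<in> {0 :: nat}. q = k} \<le> d" for k
    using card_mono[OF _ cell, of k] assms(2) by simp
  fix X
  assume "covering_game {0 :: nat} d X"
  then interpret covering_game "{0 :: nat}" d X .
  have "1 \<le> sum (X [{0}]) {0}" by (rule covered) (use assms in auto)
  moreover have "{q \<in> {0 :: nat}. q = 0} = {0}" by auto
  ultimately have "1 \<le> (\<Sum>q\<in>{q \<in> {0}. q = 0}. X [{0}] q)" by (simp only:)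
  moreover have "requests {0} d [{0 :: nat}]" using assms by simp
  ultimately show "\<exists>Cs Y k. requests {0} d Cs \<and> Cs \<noteq> [] \<and> Y \<subseteq> {0} \<and> inj_on (\<lambda>q. q) Y \<and>
      (\<forall>C\<in>set Cs. C \<inter> Y \<noteq> {}) \<and> k < 1 \<and> 1 \<le> (\<Sum>q\<in>{q \<in> {0}. q = k}. X Cs q)"
    by (intro exI[of _ "[{0}]"] exI[of _ "{0}"] exI[of _ "0::nat"] conjI) auto
qed (use assms in auto)

text \<open>A row holds \<open>L * D\<close> variables and a request at most \<open>2 * D\<close>;
  the bound \<open>2 * L * D \<le> d\<close> covers both.\<close>

lemma tournament_instance:
  assumes "0 < L" "0 < D" "2 * L * D \<le> d" "2 ^ L \<le> m" "online_algorithm m d A"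
  shows "\<exists>P cs. ompc_input m d P cs \<and> 0 < OPT P cs \<and> OPT P cs \<le> 1 \<and>
    real L * harm D / 2 \<le> objective P (A P cs)"
proof (rule instance_of_game[where U = "{..<2 ^ L} \<times> {..<L} \<times> {..<D}" and machine = fst and M = "2 ^ L"])
  let ?U = "{..<2 ^ L} \<times> {..<L} \<times> {..<D} :: (nat \<times> nat \<times> nat) set"
  have cell: "{q \<in> ?U. fst q = k} = {k} \<times> {..<L} \<times> {..<D}" if "k < 2 ^ L" for k
    using that by auto
  show "card {q \<in> ?U. fst q = k} \<le> d" for k
  proof (cases "k < 2 ^ L")
    case True
    then show ?thesis using assms(3) by (simp add: cell)
  next
    case False
    then have "{q \<in> ?U. fst q = k} = {}" by auto
    then show ?thesis by (simp only: card.empty le0)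
  qed
  fix X
  assume X: "covering_game ?U d X"
  have "1 * D \<le> L * D" using assms(1) by (intro mult_right_mono) auto
  then have "2 * D \<le> d" using assms(3) by linarith
  from tournament[OF X assms(2) this, of L 0 "[]"] assms(1)
  obtain Cs Y k where *: "requests ?U d Cs" "Cs \<noteq> []" "Y \<subseteq> ?U" "inj_on fst Y"
      "\<forall>C\<in>set Cs. C \<inter> Y \<noteq> {}" "k < 2 ^ L"
      "real L * harm D / 2 \<le> (\<Sum>i<L. \<Sum>j<D. X Cs (k, i, j))"
    by (auto simp: atLeast0LessThan)
  have "(\<Sum>q\<in>{q \<in> ?U. fst q = k}. X Cs q) = (\<Sum>i<L. \<Sum>j<D. X Cs (k, i, j))"
    unfolding cell[OF *(6)] by (simp add: sum.cartesian_product')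
  with * show "\<exists>Cs Y k. requests ?U d Cs \<and> Cs \<noteq> [] \<and> Y \<subseteq> ?U \<and> inj_on fst Y \<and>
      (\<forall>C\<in>set Cs. C \<inter> Y \<noteq> {}) \<and> k < 2 ^ L \<and>
      real L * harm D / 2 \<le> (\<Sum>q\<in>{q \<in> ?U. fst q = k}. X Cs q)"
    by (intro exI[of _ Cs] exI[of _ Y] exI[of _ k]) (simp only: simp_thms)
qed (use assms in auto)

text \<open>Chooses \<open>L\<close> and \<open>D\<close> according to the size of \<open>d\<close>.
  Nonnegativity of the objective is recorded separately because the logarithmic bound is negative
  for \<open>d < ln m\<close>.\<close>

lemma hard_instance:
  assumes m: "2 \<le> m" and d: "1 \<le> d" and A: "online_algorithm m d A"
  shows "\<exists>P cs. ompc_input m d P cs \<and> 0 < OPT P cs \<and> OPT P cs \<le> 1 \<and> 0 \<le> objective P (A P cs) \<and>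
    ln (real d / ln (real m)) * ln (real m) / 32 \<le> objective P (A P cs)"
proof -
  define t where "t = ln (real d / ln (real m)) * ln (real m)"
  define E where "E = nat \<lfloor>log 2 (real m)\<rfloor>"
  have lnm: "0 < ln (real m)" using m by simp
  have pos: "0 < real d / ln (real m)" using d lnm by simp
  \<comment> \<open>From \<open>ln z \<le> z\<close>.\<close>
  have t_le_d: "t \<le> real d"
  proof -
    have "t \<le> (real d / ln (real m)) * ln (real m)"
      unfolding t_def using ln_le_minus_one[OF pos] lnm by (intro mult_right_mono) auto
    then show ?thesis using lnm by simp
  qed
  have log1: "1 \<le> log 2 (real m)" using m by (simp add: le_log_iff)
  then have E: "real E \<le> log 2 (real m)" "log 2 (real m) < real E + 1" "1 \<le> E"
    unfolding E_def by linarith+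
  then have "2 powr real E \<le> real m" using m by (simp add: le_log_iff)
  then have "real (2 ^ E) \<le> real m" by (simp add: powr_realpow)
  then have pow_E: "2 ^ E \<le> m" by (simp only: of_nat_le_iff)
  have ln2: "1 / 2 \<le> ln (2::real)" "ln (2::real) \<le> 1"
    using ln_le_minus_one[of "1 / 2"] ln_le_minus_one[of 2] by (simp_all add: ln_div)
  text \<open>For \<open>d = 1\<close> there is no match. For small \<open>d\<close> only \<open>d div 2\<close> rounds fit into a row, but there
    the bound \<open>t \<le> d\<close> is all that is needed.\<close>
  consider "d = 1" | "2 \<le> d" "d < 2 * E" | "2 * E \<le> d" using d by linarith
  then have "\<exists>P cs. ompc_input m d P cs \<and> 0 < OPT P cs \<and> OPT P cs \<le> 1 \<and>
    max 0 (t / 32) \<le> objective P (A P cs)"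
  proof cases
    case 1
    obtain P cs where "ompc_input m d P cs" "0 < OPT P cs" "OPT P cs \<le> 1" "1 \<le> objective P (A P cs)"
      using trivial_instance[of m d A] assms by auto
    then show ?thesis using 1 t_le_d by (intro exI[of _ P] exI[of _ cs]) auto
  next
    case 2
    have "(2::nat) ^ (d div 2) \<le> 2 ^ E" using 2 by (intro power_increasing) auto
    then have "2 ^ (d div 2) \<le> m" using pow_E by (rule order.trans)
    then obtain P cs where "ompc_input m d P cs" "0 < OPT P cs" "OPT P cs \<le> 1"
        "real (d div 2) * harm 1 / 2 \<le> objective P (A P cs)"
      using tournament_instance[of "d div 2" 1 d m A] A 2 by auto
    moreover have "max 0 (t / 32) \<le> real (d div 2) * harm 1 / 2"
    proof -
      \<comment> \<open>Equality holds at \<open>d = 3\<close>, where rounding down costs the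
        most.\<close>
      have "d \<le> 3 * (d div 2)" using 2 by linarith
      then have "real d \<le> 3 * real (d div 2)" by linarith
      then show ?thesis using t_le_d by (auto simp: harm_def)
    qed
    ultimately show ?thesis by (intro exI[of _ P] exI[of _ cs]) auto
  next
    case 3
    define D where "D = d div (2 * E)"
    have D: "0 < D" "2 * E * D \<le> d" using 3 E by (auto simp: D_def div_greater_zero_iff)
    \<comment> \<open>As \<open>D \<ge> 1\<close>, the rounding in its definition loses at most a
      factor 2.\<close>
    have "d < 2 * E * Suc D" using dividend_less_times_div[of "2 * E" d] E by (simp add: D_def)
    also have "\<dots> \<le> 2 * E * (2 * D)" using D by (intro mult_left_mono) auto
    finally have "real d \<le> real (2 * E * (2 * D))" by (simp only: of_nat_le_iff less_imp_le)
    then have d4: "real d \<le> 4 * real E * real D" by simp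
    have "real E * (1 / 2) \<le> real E * ln 2" using ln2 by (intro mult_left_mono) auto
    also have "\<dots> \<le> ln (real m)" using E by (simp add: log_def field_simps)
    finally have "real E \<le> 2 * ln (real m)" by simp
    then have "4 * real E * real D \<le> 4 * (2 * ln (real m)) * real D" by (intro mult_right_mono) auto
    with d4 have "real d / ln (real m) \<le> 8 * real D" using lnm by (simp add: field_simps)
    then have "ln (real d / ln (real m)) \<le> ln (8 * real D)" using pos by (simp add: D)
    also have "\<dots> = ln 8 + ln (real D)" using D by (simp add: ln_mult_pos)
    also have "ln (real D) \<le> ln (real D + 1)" using D by simp
    also have "\<dots> \<le> harm D" by (rule ln_le_harm)
    \<comment> \<open>The additive constant 7 is absorbed by \<open>harm D \<ge> 1\<close>, which
      gives the factor 8.\<close>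
    also have "ln 8 \<le> (7::real)" using ln_le_minus_one[of 8] by simp
    finally have "ln (real d / ln (real m)) \<le> 8 * harm D"
      using harm_mono[of 1 D, where ?'a = real] D by (simp add: harm_def)
    then have "t \<le> 8 * harm D * ln (real m)" unfolding t_def using lnm by (intro mult_right_mono) auto
    \<comment> \<open>As \<open>E \<ge> 1\<close>, rounding the logarithm down costs at most a
      factor 2. The constant 32 is this 2, the 8 above and the 2 from halving
      \<open>harm D\<close>.\<close>
    also have "ln (real m) \<le> 2 * real E"
    proof -
      have "ln (real m) \<le> (real E + 1) * ln 2" using E by (simp add: log_def field_simps)
      also have "\<dots> \<le> (real E + 1) * 1" using ln2 by (intro mult_left_mono) auto
      also have "\<dots> \<le> 2 * real E" using E(3) by simp
      finally show ?thesis .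
    qed
    finally have "t \<le> 8 * harm D * (2 * real E)" using harm_nonneg[of D, where ?'a = real] by (simp add: mult_left_mono)
    then have "t / 32 \<le> real E * harm D / 2" by (simp add: field_simps)
    then have "max 0 (t / 32) \<le> real E * harm D / 2"
      by (rule max.boundedI[rotated]) (simp add: harm_nonneg)
    moreover obtain P cs where "ompc_input m d P cs" "0 < OPT P cs" "OPT P cs \<le> 1"
        "real E * harm D / 2 \<le> objective P (A P cs)"
      using tournament_instance[of E D d m A] A D E pow_E by auto
    ultimately show ?thesis by (intro exI[of _ P] exI[of _ cs]) auto
  qed
  then show ?thesis unfolding t_def by auto
qed

theorem theorem14:
  shows "\<exists>c::real. c > 0 \<and>
    (\<forall>(m::nat) (d::nat) (A::online_alg).
       m \<ge> 2 \<longrightarrow> d \<ge> 1 \<longrightarrow> online_algorithm m d A \<longrightarrow>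
         competitive_ratio m d A \<ge> ereal (c * (ln (real d / ln (real m)) * ln (real m))) \<and>
         (\<exists>P cs. ompc_input m d P cs \<and> OPT P cs > 0 \<and>
            objective P (A P cs) \<ge> c * (ln (real d / ln (real m)) * ln (real m)) * OPT P cs))"
proof (intro exI[of _ "1 / 32"] conjI allI impI)
  fix m d :: nat and A :: online_alg
  assume "2 \<le> m" "1 \<le> d" "online_algorithm m d A"
  then obtain P cs where P: "ompc_input m d P cs" "0 < OPT P cs" "OPT P cs \<le> 1"
      "0 \<le> objective P (A P cs)"
      "ln (real d / ln (real m)) * ln (real m) / 32 \<le> objective P (A P cs)"
    using hard_instance by blast
  let ?r = "1 / 32 * (ln (real d / ln (real m)) * ln (real m))"
  \<comment> \<open>Since \<open>?r\<close> may be negative, \<open>OPT \<le> 1\<close> is applied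
    to the nonnegative objective instead of to \<open>?r\<close>.\<close>
  have "?r * OPT P cs \<le> objective P (A P cs) * OPT P cs" using P by (intro mult_right_mono) auto
  also have "\<dots> \<le> objective P (A P cs)" using P by (intro mult_left_le) auto
  finally have ratio: "?r * OPT P cs \<le> objective P (A P cs)" .
  then show "\<exists>P cs. ompc_input m d P cs \<and> 0 < OPT P cs \<and> ?r * OPT P cs \<le> objective P (A P cs)"
    using P by blast
  from ratio have "?r \<le> objective P (A P cs) / OPT P cs" using P by (simp add: pos_le_divide_eq)
  then show "ereal ?r \<le> competitive_ratio m d A"
    unfolding competitive_ratio_def using P by (intro SUP_upper2[of "(P, cs)"]) auto
qed simp

end
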